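(* Let $m\ge 1$ be an integer, $V=[m]=\{1,2,\ldots,m\}$, and $B\subseteq V^2$. Let $G(v)=\sum_{k=0}^\infty m_kv^k$ be the $B$-string generating function, where $m_0=1$ and, for $k\ge 1$, $m_k$ is the number of $B$-strings of length $k$ on $V$. Then for every $n\ge 1$ and every integer $k\in[0,n-1]$, the number of sequences of length $n$ on $V$ with exactly $k$ occurrences of pairs of adjacent components in $B$ is $$[z^kv^n]\,\frac{z-1}{z-G((z-1)v)}.$$
   Context: A string $(y_1,\ldots,y_k)$ on $V$ is a $B$-string if each adjacent pair $(y_i,y_{i+1})$, $1\le i\le k-1$, belongs to $B$ (so every string of length $1$ is a $B$-string and $m_1=m$). The number of occurrences of pairs of adjacent components in $B$ in a sequence $(y_1,\ldots,y_n)$ is the number of indices $1\le i\le n-1$ with $(y_i,y_{i+1})\in B$. $[z^kv^n]F(z,v)$ denotes the coefficient of $z^kv^n$ in $F$; the quotient is expanded as a formal power series in $v$ with coefficients polynomial in $z$ (since $G(0)=1$, both the denominator and the numerator are divisible by $z-1$, and after cancelling this factor the denominator has constant term $1$ in $v$). *)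

theory Defs
  imports "HOL-Computational_Algebra.Computational_Algebra"
begin

definition is_B_string :: "nat set \<Rightarrow> (nat \<times> nat) set \<Rightarrow> nat list \<Rightarrow> bool" where
  "is_B_string V B ys \<longleftrightarrow>
     ys \<noteq> [] \<and> set ys \<subseteq> V \<and> (\<forall>i. Suc i < length ys \<longrightarrow> (ys ! i, ys ! Suc i) \<in> B)"

definition num_B_strings :: "nat set \<Rightarrow> (nat \<times> nat) set \<Rightarrow> nat \<Rightarrow> nat" where
  "num_B_strings V B k = (if k = 0 then 1 else card {ys. length ys = k \<and> is_B_string V B ys})"

definition B_string_gf :: "nat set \<Rightarrow> (nat \<times> nat) set \<Rightarrow> 'a::semiring_1 fps" where
  "B_string_gf V B = Abs_fps (\<lambda>k. of_nat (num_B_strings V B k))"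

definition num_B_occurrences :: "(nat \<times> nat) set \<Rightarrow> nat list \<Rightarrow> nat" where
  "num_B_occurrences B ys = card {i. Suc i < length ys \<and> (ys ! i, ys ! Suc i) \<in> B}"

text \<open>Series in \<open>v\<close> live in \<open>\<int>(z)[[v]]\<close>, modelled as \<^typ>\<open>int poly fract fps\<close>: there
  \<open>z - G((z - 1)v)\<close> has the nonzero constant term \<open>z - 1\<close>, so the library division is the
  genuine quotient of power series in \<open>v\<close>.\<close>

definition zvar :: "int poly fract" where
  "zvar = to_fract [:0, 1:]"

text \<open>The coefficientwise embedding of \<open>\<int>[z][[v]]\<close> into \<open>\<int>(z)[[v]]\<close>. It is injective, so a
  series in its image has a unique preimage, from which coefficients of \<open>z\<close> can be read off.\<close>

definition fps_to_fract :: "int poly fps \<Rightarrow> int poly fract fps" where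
  "fps_to_fract P = Abs_fps (\<lambda>n. to_fract (fps_nth P n))"

lemma fps_to_fract_inject: "fps_to_fract P = fps_to_fract Q \<longleftrightarrow> P = Q"
  by (simp add: fps_to_fract_def fps_eq_iff)

end

theory Submission
  imports Defs
begin

text \<open>
  Write \<open>w = z - 1\<close> and let \<open>A\<^sub>n\<close> be the sum of \<open>z ^ occ ys\<close> over all words \<open>ys\<close> of length
  \<open>n\<close>, where \<open>occ\<close> counts the adjacent pairs in \<open>B\<close>. Expanding \<open>z ^ occ ys = (1 + w) ^ occ ys\<close>
  amounts to marking an arbitrary subset of the occurrences, each mark having weight \<open>w\<close>. The
  marked pairs that chain up from the first letter form a \<open>B\<close>-string of some length \<open>j \<ge> 1\<close>
  with weight \<open>w ^ (j - 1)\<close>; the pair straddling its end, if any, is unmarked, and the rest is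
  an arbitrary marked word of length \<open>n - j\<close>. Hence \<open>A\<^sub>n = (\<Sum>j=1..n. m\<^sub>j * w ^ (j - 1) * A\<^sub>n\<^sub>-\<^sub>j)\<close>
  for \<open>n \<ge> 1\<close>; the word-by-word form of this is \<open>power_occurrences_eq_sum_prefixes\<close>, the summed
  form is \<open>occurrence_poly_recurrence\<close>.

  After multiplication by \<open>w\<close> and together with \<open>A\<^sub>0 = 1\<close>, the recurrence says
  \<open>A(v) * (z - G(w v)) = w\<close> (\<open>occurrence_gf_mult\<close>). It holds for \<open>z\<close> in
  any commutative ring, in particular for the indeterminate in \<open>\<int>(z)\<close>. There the division is
  possible, and the quotient \<open>A(v)\<close> visibly comes from \<open>\<int>[z][[v]]\<close>.
\<close>

definition words :: "nat set \<Rightarrow> nat \<Rightarrow> nat list set" where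
  "words V n = {ys. length ys = n \<and> set ys \<subseteq> V}"

text \<open>
  The weight \<open>z\<close> ranges over an arbitrary commutative ring: the functional equation is used for
  \<open>z\<close> in \<open>\<int>(z)\<close>, where one can divide, and coefficients are read off for \<open>z\<close> in \<open>\<int>[z]\<close>.
\<close>

definition occurrence_poly :: "nat set \<Rightarrow> (nat \<times> nat) set \<Rightarrow> 'a::comm_ring_1 \<Rightarrow> nat \<Rightarrow> 'a" where
  "occurrence_poly V B z n = (\<Sum>ys\<in>words V n. z ^ num_B_occurrences B ys)"

lemma finite_words: "finite V \<Longrightarrow> finite (words V n)"
  using finite_lists_length_eq[of V n] by (simp add: words_def conj_commute)

lemma num_B_occurrences_Nil [simp]: "num_B_occurrences B [] = 0"
  and num_B_occurrences_single [simp]: "num_B_occurrences B [x] = 0"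
  by (simp_all add: num_B_occurrences_def)

lemma num_B_occurrences_Cons_Cons [simp]:
  "num_B_occurrences B (x # y # r) = of_bool ((x, y) \<in> B) + num_B_occurrences B (y # r)"
proof -
  let ?S = "{i. Suc i < length (y # r) \<and> ((y # r) ! i, (y # r) ! Suc i) \<in> B}"
  have "{i. Suc i < length (x # y # r) \<and> ((x # y # r) ! i, (x # y # r) ! Suc i) \<in> B}
      = (if (x, y) \<in> B then {0} else {}) \<union> Suc ` ?S" (is "?L = ?R")
  proof (rule set_eqI)
    show "i \<in> ?L \<longleftrightarrow> i \<in> ?R" for i by (cases i) auto
  qed
  moreover have "finite ?S" by (rule finite_subset[of _ "{..<length (y # r)}"]) auto
  ultimately show ?thesis
    by (simp add: num_B_occurrences_def card_image)
qed

lemma is_B_string_single [simp]: "is_B_string V B [x] \<longleftrightarrow> x \<in> V"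
  and is_B_string_Nil [simp]: "\<not> is_B_string V B []"
  by (auto simp: is_B_string_def)

lemma is_B_string_Cons_Cons [simp]:
  "is_B_string V B (x # y # r) \<longleftrightarrow> x \<in> V \<and> (x, y) \<in> B \<and> is_B_string V B (y # r)"
proof -
  have "(\<forall>i. Suc i < length (x # y # r) \<longrightarrow> ((x # y # r) ! i, (x # y # r) ! Suc i) \<in> B)
     \<longleftrightarrow> (x, y) \<in> B \<and> (\<forall>i. Suc i < length (y # r) \<longrightarrow> ((y # r) ! i, (y # r) ! Suc i) \<in> B)"
    (is "(\<forall>i. ?P i) \<longleftrightarrow> ?Q \<and> (\<forall>i. ?R i)")
  proof -
    have "(\<forall>i. ?P i) \<longleftrightarrow> ?P 0 \<and> (\<forall>i. ?P (Suc i))" by (metis not0_implies_Suc)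
    then show ?thesis by simp
  qed
  then show ?thesis by (auto simp: is_B_string_def)
qed

text \<open>
  The index \<open>j\<close> is one less than the length of the initial block that is chained by marks.
  Whether the first pair \<open>(x, y)\<close> is marked decides between the term \<open>j = 0\<close> and the others; the
  latter are \<open>w\<close> times the expansion of the tail if \<open>(x, y) \<in> B\<close> and vanish otherwise, so both
  sides get multiplied by \<open>1 + w = z\<close> or by \<open>1\<close>.
\<close>

lemma power_occurrences_eq_sum_prefixes:
  fixes z :: "'a::comm_ring_1"
  assumes "ys \<noteq> []" "set ys \<subseteq> V"
  shows "z ^ num_B_occurrences B ys =
    (\<Sum>j<length ys. of_bool (is_B_string V B (take (Suc j) ys)) * (z - 1) ^ j
        * z ^ num_B_occurrences B (drop (Suc j) ys))"
  using assms
proof (induction ys rule: induct_list012)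
  case (3 x y r)
  let ?t = "\<lambda>ys j. of_bool (is_B_string V B (take (Suc j) ys)) * (z - 1) ^ j
        * z ^ num_B_occurrences B (drop (Suc j) ys)"
  have shift: "?t (x # y # r) (Suc j) = (of_bool ((x, y) \<in> B) * (z - 1)) * ?t (y # r) j" for j
    using 3(4) by (simp add: algebra_simps)
  have "(\<Sum>j<length (x # y # r). ?t (x # y # r) j)
      = ?t (x # y # r) 0 + (\<Sum>j<length (y # r). ?t (x # y # r) (Suc j))"
    by (simp only: length_Cons[of x] sum.lessThan_Suc_shift)
  also have "\<dots> = z ^ num_B_occurrences B (y # r)
      + (of_bool ((x, y) \<in> B) * (z - 1)) * (\<Sum>j<length (y # r). ?t (y # r) j)"
    unfolding shift sum_distrib_left[symmetric] using 3(4) by simp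
  also have "(\<Sum>j<length (y # r). ?t (y # r) j) = z ^ num_B_occurrences B (y # r)"
    using 3 by (intro 3(2)[symmetric]) auto
  also have "z ^ num_B_occurrences B (y # r)
      + (of_bool ((x, y) \<in> B) * (z - 1)) * z ^ num_B_occurrences B (y # r)
      = z ^ num_B_occurrences B (x # y # r)"
    by (simp add: algebra_simps)
  finally show ?case by simp
qed auto

lemma sum_words_add:
  "(\<Sum>ys\<in>words V (a + b). f (take a ys) (drop a ys)) = (\<Sum>us\<in>words V a. \<Sum>vs\<in>words V b. f us vs)"
  unfolding sum.cartesian_product
  by (rule sum.reindex_bij_witness[of _ "\<lambda>(us, vs). us @ vs" "\<lambda>ys. (take a ys, drop a ys)"])
     (auto simp: words_def dest: in_set_takeD in_set_dropD)

lemma num_B_strings_Suc: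
  assumes "finite V"
  shows "of_nat (num_B_strings V B (Suc j)) = (\<Sum>us\<in>words V (Suc j). of_bool (is_B_string V B us))"
proof -
  have "{ys. length ys = Suc j \<and> is_B_string V B ys} = {us \<in> words V (Suc j). is_B_string V B us}"
    by (auto simp: words_def is_B_string_def)
  then show ?thesis
    using assms by (simp add: num_B_strings_def sum_of_bool_eq finite_words Int_def)
qed

lemma occurrence_poly_recurrence:
  fixes z :: "'a::comm_ring_1"
  assumes "finite V" "n > 0"
  shows "occurrence_poly V B z n =
    (\<Sum>j<n. of_nat (num_B_strings V B (Suc j)) * (z - 1) ^ j * occurrence_poly V B z (n - Suc j))"
proof -
  let ?f = "\<lambda>j us vs. of_bool (is_B_string V B us) * (z - 1) ^ j * z ^ num_B_occurrences B vs"
  have "occurrence_poly V B z n =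
      (\<Sum>ys\<in>words V n. \<Sum>j<n. ?f j (take (Suc j) ys) (drop (Suc j) ys))"
    unfolding occurrence_poly_def
  proof (rule sum.cong[OF refl])
    fix ys assume "ys \<in> words V n"
    then have ys: "length ys = n" "set ys \<subseteq> V" "ys \<noteq> []" using assms by (auto simp: words_def)
    show "z ^ num_B_occurrences B ys = (\<Sum>j<n. ?f j (take (Suc j) ys) (drop (Suc j) ys))"
      using power_occurrences_eq_sum_prefixes[OF ys(3,2), where z = z and B = B]
      unfolding ys(1) .
  qed
  also have "\<dots> = (\<Sum>j<n. \<Sum>ys\<in>words V n. ?f j (take (Suc j) ys) (drop (Suc j) ys))"
    by (rule sum.swap)
  also have "\<dots> = (\<Sum>j<n. \<Sum>us\<in>words V (Suc j). \<Sum>vs\<in>words V (n - Suc j). ?f j us vs)"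
  proof (rule sum.cong[OF refl])
    fix j assume "j \<in> {..<n}"
    then have "n = Suc j + (n - Suc j)" by simp
    then show "(\<Sum>ys\<in>words V n. ?f j (take (Suc j) ys) (drop (Suc j) ys))
        = (\<Sum>us\<in>words V (Suc j). \<Sum>vs\<in>words V (n - Suc j). ?f j us vs)"
      using sum_words_add[where f = "?f j" and a = "Suc j" and b = "n - Suc j" and V = V] by simp
  qed
  also have "\<dots> = (\<Sum>j<n. of_nat (num_B_strings V B (Suc j)) * (z - 1) ^ j
      * occurrence_poly V B z (n - Suc j))"
    unfolding num_B_strings_Suc[OF assms(1)] occurrence_poly_def
    by (simp only: sum_distrib_left[symmetric] sum_distrib_right[symmetric])
  finally show ?thesis .
qed

lemma occurrence_poly_0 [simp]: "occurrence_poly V B z 0 = 1"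
proof -
  have "words V 0 = {[]}" by (auto simp: words_def)
  then show ?thesis by (simp add: occurrence_poly_def)
qed

lemma occurrence_gf_mult:
  fixes z :: "'a::comm_ring_1"
  assumes "finite V"
  shows "(fps_const z - fps_compose (B_string_gf V B) (fps_const (z - 1) * fps_X))
      * Abs_fps (occurrence_poly V B z) = fps_const (z - 1)"
    (is "?D * ?A = _")
proof (rule fps_ext)
  let ?m = "\<lambda>j. of_nat (num_B_strings V B j) :: 'a" and ?A = "occurrence_poly V B z"
  have D: "?D $ j = (if j = 0 then z - 1 else - ((z - 1) ^ j * ?m j))" for j
    by (simp add: fps_compose_linear B_string_gf_def num_B_strings_def)
  show "(?D * Abs_fps ?A) $ n = fps_const (z - 1) $ n" for n
  proof (cases n)
    case 0
    then show ?thesis by (simp add: D del: fps_sub_nth)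
  next
    case (Suc k)
    have "(?D * Abs_fps ?A) $ n
        = ?D $ 0 * ?A n + (\<Sum>j<n. ?D $ Suc j * ?A (n - Suc j))"
      by (simp add: fps_mult_nth sum.lessThan_Suc_shift atLeast0AtMost flip: lessThan_Suc_atMost
          del: sum.lessThan_Suc fps_sub_nth)
    also have "(\<Sum>j<n. ?D $ Suc j * ?A (n - Suc j))
        = - ((z - 1) * (\<Sum>j<n. ?m (Suc j) * (z - 1) ^ j * ?A (n - Suc j)))"
      unfolding D sum_distrib_left sum_negf[symmetric] by (simp add: algebra_simps)
    also have "(\<Sum>j<n. ?m (Suc j) * (z - 1) ^ j * ?A (n - Suc j)) = ?A n"
      using Suc by (intro occurrence_poly_recurrence[OF assms, symmetric]) simp
    finally show ?thesis using Suc by (simp add: D del: fps_sub_nth)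
  qed
qed

lemma occurrence_poly_to_fract:
  "occurrence_poly V B (to_fract z) n = to_fract (occurrence_poly V B z n)"
proof -
  have pow: "to_fract (z ^ k) = to_fract z ^ k" for k
    by (induction k) simp_all
  have "to_fract (\<Sum>y\<in>S. f y) = (\<Sum>y\<in>S. to_fract (f y))" for S :: "nat list set" and f :: "_ \<Rightarrow> 'a"
    by (induction S rule: infinite_finite_induct) simp_all
  then show ?thesis by (simp add: occurrence_poly_def pow)
qed

lemma coeff_occurrence_poly:
  assumes "finite V"
  shows "coeff (occurrence_poly V B [:0, 1 :: int:] n) k
    = int (card {ys. length ys = n \<and> set ys \<subseteq> V \<and> num_B_occurrences B ys = k})"
proof -
  have "coeff (occurrence_poly V B [:0, 1 :: int:] n) k
      = (\<Sum>ys\<in>words V n. of_bool (num_B_occurrences B ys = k))"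
    unfolding occurrence_poly_def coeff_sum
    by (intro sum.cong) (auto simp flip: monom_altdef[of 1, simplified])
  also have "\<dots> = int (card {ys \<in> words V n. num_B_occurrences B ys = k})"
    using assms by (simp add: sum_of_bool_eq finite_words Int_def)
  finally show ?thesis by (simp add: words_def conj_assoc)
qed

theorem corollary6p1:
  fixes m :: nat and V :: "nat set" and B :: "(nat \<times> nat) set"
  assumes "m \<ge> 1"
    and "V = {1..m}"
    and "B \<subseteq> V \<times> V"
  shows "\<exists>P :: int poly fps.
           fps_const (zvar - 1) /
             (fps_const zvar - fps_compose (B_string_gf V B) (fps_const (zvar - 1) * fps_X))
             = fps_to_fract P \<and>
           (\<forall>n\<ge>1. \<forall>k\<in>{0..n - 1}.
              int (card {ys. length ys = n \<and> set ys \<subseteq> V \<and> num_B_occurrences B ys = k})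
                = poly.coeff (fps_nth P n) k)"
proof (intro exI conjI)
  let ?P = "Abs_fps (occurrence_poly V B [:0, 1 :: int:])"
  let ?D = "fps_const zvar - fps_compose (B_string_gf V B) (fps_const (zvar - 1) * fps_X)"
  have fin: "finite V" using assms by simp
  have "fps_to_fract ?P = Abs_fps (occurrence_poly V B zvar)"
    by (rule fps_ext) (simp add: fps_to_fract_def zvar_def occurrence_poly_to_fract)
  then have prod: "?D * fps_to_fract ?P = fps_const (zvar - 1)"
    using occurrence_gf_mult[OF fin, where z = zvar and B = B] by simp
  have "zvar \<noteq> 1"
    unfolding zvar_def to_fract_1[symmetric] to_fract_eq_iff by (simp add: one_pCons)
  then have "?D \<noteq> 0" using prod by (metis fps_const_eq_0_iff mult_zero_left right_minus_eq)
  then show "fps_const (zvar - 1) / ?D = fps_to_fract ?P"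
    using nonzero_mult_div_cancel_left[OF \<open>?D \<noteq> 0\<close>, of "fps_to_fract ?P"]
    by (simp only: prod)
  show "\<forall>n\<ge>1. \<forall>k\<in>{0..n - 1}.
      int (card {ys. length ys = n \<and> set ys \<subseteq> V \<and> num_B_occurrences B ys = k})
        = poly.coeff (fps_nth ?P n) k"
    by (simp add: coeff_occurrence_poly[OF fin])
qed

end
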